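(* For every infinite sequence $n_0n_1n_2\cdots$ of positive integers with $n_0=2$, one has $n_0n_1\cdots\notin\mathrm{ENSH}^2_2$; that is, there exists $r>0$ such that $\mathrm{ENSH}^2_2(n_0\cdots n_{r-1})$ does not hold.
   Context: Identify $2$ with $\{0,1\}$; $2^n$ is the set of binary words of length $n$. A variable word (over $2$) is a sequence $v$ with entries in $\{0,1\}\cup\{x_0,x_1,\dots\}$, the $x_m$ being variables; the first occurrence of a variable $x_m$ occurring in $v$ is $\min\{t:v(t)=x_m\}$. An $n$-variable word is a variable word in which exactly $n$ variables occur, with the convention that the first occurrences are increasing in the variable index. For a finite $n$-variable word $v$ and $\vec a\in 2^n$, $v(\vec a)$ is the binary word obtained by replacing the $j$-th variable occurring in $v$ (in order of index) by $\vec a(j)$, for all $j<n$. Let $n_0,\dots,n_{r-1}$ be positive integers, $N=n_0+\cdots+n_{r-1}$, and $N_s=\{n_0+\cdots+n_{s-1},\dots,n_0+\cdots+n_s-1\}$ for $s\le r-1$. For $f:2^N\to 2$, the sequence $n_0\cdots n_{r-1}$ is sectionally-homogeneous for $f$ if there exist $s\le r-1$ and an $n_s$-variable word $v$ of length $N$ such that the set of first occurrences of the variables occurring in $v$ is exactly $N_s$ and $f$ is constant on $\{v(\vec a):\vec a\in 2^{n_s}\}$. $\mathrm{ENSH}^2_2(n_0\cdots n_{r-1})$ holds if there exists $f:2^N\to 2$ such that $n_0\cdots n_{r-1}$ is not sectionally-homogeneous for $f$. $\mathrm{ENSH}^2_2$ also denotes the set of infinite sequences of positive integers all of whose nonempty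 finite initial segments satisfy $\mathrm{ENSH}^2_2(\cdot)$. *)

theory Defs
  imports Main
begin

text \<open>The set \<open>2 = {0, 1}\<close> is rendered as \<^typ>\<open>bool\<close>, and finite words as lists
  with positions counted from \<open>0\<close>.\<close>

definition words :: "nat \<Rightarrow> bool list set"
  where "words n = {w. length w = n}"

datatype letter = Const bool | Var nat

type_synonym variable_word = "letter list"

definition vars :: "variable_word \<Rightarrow> nat set"
  where "vars v = {m. Var m \<in> set v}"

definition first_occurrence :: "variable_word \<Rightarrow> nat \<Rightarrow> nat"
  where "first_occurrence v m = (LEAST t. t < length v \<and> v ! t = Var m)"

definition is_variable_word :: "nat \<Rightarrow> variable_word \<Rightarrow> bool"
  where "is_variable_word n v \<longleftrightarrow>
    card (vars v) = n \<and> strict_mono_on (vars v) (first_occurrence v)"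

text \<open>The variables occurring in \<open>v\<close> need not be an initial segment of all variables, so \<open>Var m\<close>
  is replaced by the entry of \<open>a\<close> whose position is the rank of \<open>m\<close> among the indices of the
  variables occurring in \<open>v\<close>. Meaningful if \<open>length a = card (vars v)\<close>.\<close>

definition var_rank :: "variable_word \<Rightarrow> nat \<Rightarrow> nat"
  where "var_rank v m = card {k \<in> vars v. k < m}"

definition substitute :: "variable_word \<Rightarrow> bool list \<Rightarrow> bool list"
  where "substitute v a =
    map (\<lambda>c. case c of Const b \<Rightarrow> b | Var m \<Rightarrow> a ! var_rank v m) v"

definition block :: "nat list \<Rightarrow> nat \<Rightarrow> nat set"
  where "block ns s = {sum_list (take s ns) ..< sum_list (take (Suc s) ns)}"

text \<open>A colouring of \<open>words (sum_list ns)\<close> is given by a function on all binary words, of which only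
  the values on \<open>words (sum_list ns)\<close> are used.\<close>

definition sectionally_homogeneous :: "(bool list \<Rightarrow> bool) \<Rightarrow> nat list \<Rightarrow> bool"
  where "sectionally_homogeneous f ns \<longleftrightarrow>
    (\<exists>s < length ns. \<exists>v.
       is_variable_word (ns ! s) v \<and> length v = sum_list ns \<and>
       first_occurrence v ` vars v = block ns s \<and>
       (\<exists>c. \<forall>a \<in> words (ns ! s). f (substitute v a) = c))"

definition ENSH :: "nat list \<Rightarrow> bool"
  where "ENSH ns \<longleftrightarrow> (\<exists>f. \<not> sectionally_homogeneous f ns)"

definition ENSH_seqs :: "(nat \<Rightarrow> nat) set"
  where "ENSH_seqs = {n. (\<forall>i. n i > 0) \<and> (\<forall>r > 0. ENSH (map n [0..<r]))}"

end

theory Submission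
  imports Defs "HOL-Library.Nat_Bijection" "HOL-Library.Disjoint_Sets"
    "HOL-Library.Infinite_Set"
begin

text \<open>Suppose that every initial segment satisfies \<open>ENSH\<close>. By compactness there is one colouring
  \<open>g\<close> of the finite sets of positions that is constant on no cube whose directions start at the
  elements of a block. Fixing the first two letters splits \<open>g\<close> into \<open>x, y, z, w\<close>, and the first
  block says that \<open>x A = y (A \<union> X1) = z (A \<union> X0) = w (A \<union> X0 \<union> X1)\<close> never holds for disjoint sets.
  A counting argument produces, on any finite \<open>N\<close>, translates of these functions for which
  \<open>z a = (\<not> y (N - a))\<close>. With \<open>rho a = w (N - a)\<close> this becomes an exchange rule: for disjoint
  \<open>A, R, X\<close>, if \<open>x A = rho R = c\<close> and \<open>y (A \<union> X) = c\<close> then \<open>y (R \<union> X) = c\<close>. In the limit \<open>N \<rightarrow> \<nat>\<close>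
  the rule forces \<open>x = rho\<close> away from a finite set, and then \<open>x\<close> and \<open>y\<close> are parity functions up to a
  constant, hence constant on a cube all of whose directions have even parity.\<close>

section \<open>Cubes of finite sets and colourings without constant cubes\<close>

abbreviation interval :: "(nat \<Rightarrow> nat) \<Rightarrow> nat \<Rightarrow> nat set"
  where "interval b s \<equiv> {b s..<b (Suc s)}"

text \<open>The cube of a variable word: \<open>U\<close> is the set of positions with constant \<open>1\<close>, and the
  variable whose first occurrence is \<open>i\<close> occurs in \<open>insert i (Y i)\<close>.\<close>

definition is_cube :: "(nat \<Rightarrow> nat) \<Rightarrow> nat \<Rightarrow> nat set \<Rightarrow> (nat \<Rightarrow> nat set) \<Rightarrow> bool"
  where "is_cube b s U Y \<longleftrightarrow> finite U \<and> U \<inter> interval b s = {} \<and>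
    (\<forall>i \<in> interval b s. finite (Y i) \<and> Y i \<subseteq> {b (Suc s)..} \<and> Y i \<inter> U = {}) \<and>
    disjoint_family_on Y (interval b s)"

definition cube_point :: "nat set \<Rightarrow> (nat \<Rightarrow> nat set) \<Rightarrow> nat set \<Rightarrow> nat set"
  where "cube_point U Y a = U \<union> a \<union> (\<Union>i\<in>a. Y i)"

text \<open>Finite sets stand for infinite binary words of finite support, so one colouring serves
  all lengths and all blocks at once.\<close>

definition cube_free :: "(nat \<Rightarrow> nat) \<Rightarrow> (nat set \<Rightarrow> bool) \<Rightarrow> bool"
  where "cube_free b g \<longleftrightarrow>
    (\<forall>s U Y c. is_cube b s U Y \<longrightarrow> (\<exists>a \<subseteq> interval b s. g (cube_point U Y a) \<noteq> c))"

lemma cube_freeD: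
  assumes "cube_free b g" "is_cube b s U Y"
  shows "\<exists>a \<subseteq> interval b s. g (cube_point U Y a) \<noteq> c"
  using assms unfolding cube_free_def by blast

lemma cube_free_interval:
  assumes "cube_free b g" "finite U" "U \<inter> interval b s = {}"
  shows "\<exists>a \<subseteq> interval b s. g (U \<union> a) \<noteq> c"
proof -
  have "is_cube b s U (\<lambda>_. {})"
    using assms by (auto simp: is_cube_def disjoint_family_on_def)
  from cube_freeD[OF assms(1) this] show ?thesis
    by (auto simp: cube_point_def)
qed

lemma is_cube_extend:
  assumes "is_cube b s U Y" "finite E" "E \<inter> (interval b s \<union> (\<Union>i\<in>interval b s. Y i)) = {}"
  shows "is_cube b s (U \<union> E) Y"
  using assms unfolding is_cube_def by blast

lemma cube_free_complement:
  "cube_free b (\<lambda>S. \<not> g S) \<longleftrightarrow> cube_free b g"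
  unfolding cube_free_def by (metis (full_types))

lemma eventually_interval_disjoint:
  assumes "strict_mono b" "finite D"
  shows "\<exists>s0. \<forall>s \<ge> s0. interval b s \<inter> D = {}"
proof -
  from assms(2) obtain m where m: "\<forall>d \<in> D. d < m"
    using finite_nat_set_iff_bounded by blast
  have "s \<le> b s" for s
    using strict_mono_imp_increasing[OF assms(1)] .
  then show ?thesis
    using m by (intro exI[of _ m]) (force dest: order_trans)
qed

text \<open>A block far enough out misses \<open>U\<close> and \<open>D\<close>; its subsets added
  to \<open>U\<close> form a cube, on which \<open>g\<close> takes both values.\<close>

lemma cube_free_dense:
  assumes "strict_mono b" "cube_free b g" "finite U" "finite D"
  shows "\<exists>X. finite X \<and> X \<inter> D = {} \<and> g (U \<union> X) = c"
proof -
  obtain s where s: "interval b s \<inter> (U \<union> D) = {}"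
    using eventually_interval_disjoint[OF assms(1), of "U \<union> D"] assms by blast
  obtain a where "a \<subseteq> interval b s" "g (U \<union> a) \<noteq> (\<not> c)"
    using cube_free_interval[OF assms(2,3), of s "\<not> c"] s by blast
  moreover from this have "finite a"
    using finite_subset by blast
  ultimately show ?thesis
    using s by (intro exI[of _ a]) blast
qed

section \<open>Compactness: cluster points of sequences of colourings\<close>

text \<open>Diagonal argument: nested infinite index sets are chosen so that coordinate
  \<open>k\<close> is constant on the \<open>k\<close>-th set. A member of that set beyond
  \<open>L\<close> agrees with the limit on all coordinates up to \<open>k\<close>.\<close>

lemma infinite_cluster_sequence:
  fixes F :: "nat \<Rightarrow> nat \<Rightarrow> 'c::finite"
  shows "\<exists>G. \<forall>k L. \<exists>M \<ge> L. \<forall>j \<le> k. F M j = G j"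
proof -
  have pigeon: "\<exists>I' c. infinite I' \<and> I' \<subseteq> I \<and> (\<forall>M \<in> I'. F M k = c)" if "infinite I" for I k
  proof -
    have "finite ((\<lambda>M. F M k) ` I)"
      by (rule finite_subset[OF subset_UNIV]) simp
    from pigeonhole_infinite[OF that this] obtain M0
      where "infinite {M \<in> I. F M k = F M0 k}" by auto
    then show ?thesis by (intro exI[of _ "{M \<in> I. F M k = F M0 k}"]) auto
  qed
  have "\<exists>p. \<forall>k. (infinite (fst (p k)) \<and> (\<forall>M \<in> fst (p k). F M k = snd (p k)))
      \<and> fst (p (Suc k)) \<subseteq> fst (p k)"
  proof (rule dependent_nat_choice)
    show "\<exists>p. infinite (fst p) \<and> (\<forall>M \<in> fst p. F M 0 = snd p)"
      using pigeon[OF infinite_UNIV_nat, of 0] by force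
  next
    fix p :: "nat set \<times> 'c" and k
    assume "infinite (fst p) \<and> (\<forall>M \<in> fst p. F M k = snd p)"
    then show "\<exists>q. (infinite (fst q) \<and> (\<forall>M \<in> fst q. F M (Suc k) = snd q)) \<and> fst q \<subseteq> fst p"
      using pigeon[of "fst p" "Suc k"] by force
  qed
  then obtain p where inf: "\<And>k. infinite (fst (p k))"
    and val: "\<And>k M. M \<in> fst (p k) \<Longrightarrow> F M k = snd (p k)"
    and dec: "\<And>k. fst (p (Suc k)) \<subseteq> fst (p k)" by blast
  have anti: "fst (p k) \<subseteq> fst (p j)" if "j \<le> k" for j k
    using lift_Suc_antimono_le[of "\<lambda>k. fst (p k)"] dec that by blast
  have "\<exists>M \<ge> L. \<forall>j \<le> k. F M j = snd (p j)" for k L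
  proof -
    obtain M where "M \<ge> L" "M \<in> fst (p k)"
      using inf[of k] by (auto simp: infinite_nat_iff_unbounded_le)
    then show ?thesis using anti val by blast
  qed
  then show ?thesis by (intro exI[of _ "\<lambda>j. snd (p j)"]) blast
qed

text \<open>\<open>set_encode\<close> numbers the finite sets, so agreement on finitely many of them
  follows from agreement up to the largest code.\<close>

lemma infinite_cluster_finite_sets:
  fixes F :: "nat \<Rightarrow> nat set \<Rightarrow> 'c::finite"
  shows "\<exists>G. \<forall>K L. finite K \<longrightarrow> (\<forall>S \<in> K. finite S) \<longrightarrow> (\<exists>M \<ge> L. \<forall>S \<in> K. F M S = G S)"
proof -
  obtain G where G: "\<And>k L. \<exists>M \<ge> L. \<forall>j \<le> k. F M (set_decode j) = G j"
    using infinite_cluster_sequence[of "\<lambda>M j. F M (set_decode j)"] by blast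
  have "\<exists>M \<ge> L. \<forall>S \<in> K. F M S = G (set_encode S)"
    if K: "finite K" "\<forall>S \<in> K. finite S" for K L
  proof -
    obtain M where "M \<ge> L" and M: "\<forall>j \<le> Max (set_encode ` K). F M (set_decode j) = G j"
      using G by blast
    have "F M S = G (set_encode S)" if "S \<in> K" for S
    proof -
      have "set_encode S \<le> Max (set_encode ` K)"
        using that K by simp
      then show ?thesis
        using M K(2) that by (metis set_encode_inverse)
    qed
    then show ?thesis using \<open>M \<ge> L\<close> by blast
  qed
  then show ?thesis by (intro exI[of _ "\<lambda>S. G (set_encode S)"]) blast
qed

section \<open>The exchange rule and parity functions\<close>

text \<open>Choose \<open>X\<close> such that \<open>y (a \<union> X)\<close> holds for as many subsets \<open>a\<close> of a block as possible. Adding a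
  set outside \<open>x\<close> can only enlarge this family, so it does not change it. If \<open>F\<close> is a far set with
  \<open>rho F\<close> and \<open>\<not> x F\<close>, then no set \<open>R\<close> beyond \<open>F\<close> can enlarge it either: for \<open>x R\<close> exchange \<open>R\<close>
  with \<open>F\<close>. So \<open>y\<close> is constant beyond some \<open>a \<union> X\<close>.\<close>

lemma eventual_implication:
  assumes b: "strict_mono b" and free: "cube_free b y"
    and empty: "\<not> x {}" "\<not> rho {}"
    and star: "\<And>A R X c. \<lbrakk>finite A; finite R; finite X; A \<inter> R = {}; A \<inter> X = {}; R \<inter> X = {};
      x A = c; rho R = c; y (A \<union> X) = c\<rbrakk> \<Longrightarrow> y (R \<union> X) = c"
  shows "\<exists>D. finite D \<and> (\<forall>F. finite F \<and> F \<inter> D = {} \<and> rho F \<longrightarrow> x F)"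
proof -
  define N where "N = interval b 0"
  have finN: "finite N" by (simp add: N_def)
  define ones where "ones X = {a \<in> Pow N. y (a \<union> X)}" for X
  have finones: "finite (ones X)" for X
    using finN by (simp add: ones_def)
  have "card (ones X) \<le> card (Pow N)" for X
    using finN by (intro card_mono) (auto simp: ones_def)
  then have bound: "card (ones X) < Suc (card (Pow N))" for X
    by (simp add: less_Suc_eq_le)
  obtain X where X: "finite X" "X \<inter> N = {}"
    and maxX: "\<And>X'. finite X' \<Longrightarrow> X' \<inter> N = {} \<Longrightarrow> card (ones X') \<le> card (ones X)"
    using ex_has_greatest_nat[of "\<lambda>X. finite X \<and> X \<inter> N = {}" "{}" "\<lambda>X. card (ones X)"
        "Suc (card (Pow N))"] bound by (auto simp: less_imp_le)
  have fixed: "y (A \<union> (a \<union> X)) = y (a \<union> X)"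
    if A: "finite A" "A \<inter> (N \<union> X) = {}" "\<not> x A" and a: "a \<subseteq> N" for A a
  proof -
    have "ones X \<subseteq> ones (X \<union> A)"
    proof
      fix a' assume a': "a' \<in> ones X"
      \<comment> \<open>\<open>A\<close> is exchanged with the empty set for the colour
        \<open>False\<close>: a zero of \<open>y\<close> at
        \<open>A \<union> (a' \<union> X)\<close> would give a zero at
        \<open>a' \<union> X\<close>.\<close>
      then have "y (A \<union> (a' \<union> X))"
        using star[of A "{}" "a' \<union> X" False] A X finN empty finite_subset[of a' N]
        by (auto simp: ones_def)
      then show "a' \<in> ones (X \<union> A)"
        using a' by (auto simp: ones_def ac_simps)
    qed
    then have "ones X = ones (X \<union> A)"
      using maxX[of "X \<union> A"] A X finones by (intro card_seteq) auto
    then show ?thesis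
      using a by (auto simp: ones_def ac_simps set_eq_iff[of _ "Collect _"])
  qed
  have "x F" if F: "finite F" "F \<inter> (N \<union> X) = {}" "rho F" for F
  proof (rule ccontr)
    assume xF: "\<not> x F"
    obtain a where a: "a \<subseteq> N" "\<not> y (a \<union> X)"
      using cube_free_interval[OF free X(1), of 0 True] X(2) by (auto simp: N_def Un_commute)
    have fina: "finite a"
      using a finN finite_subset by blast
    obtain R where R: "finite R" "R \<inter> (N \<union> X \<union> F) = {}" "y ((a \<union> X) \<union> R)"
      using cube_free_dense[OF b free, of "a \<union> X" "N \<union> X \<union> F" True] X finN F fina by auto
    have "\<not> y (F \<union> (a \<union> X))"
      using fixed[OF F(1,2) xF a(1)] a(2) by simp
    moreover have "y (R \<union> (a \<union> X))" using R(3) by (simp add: ac_simps)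
    ultimately have "\<not> x R"
      using star[of R F "a \<union> X" True] R F X a fina by blast
    then show False
      using fixed[of R a] R a \<open>y (R \<union> (a \<union> X))\<close> by auto
  qed
  then show ?thesis
    using X finN by (intro exI[of _ "N \<union> X"]) auto
qed

lemma no_exchange_structure:
  assumes b: "strict_mono b" and free: "cube_free b y"
    and nonzero: "\<And>s. \<exists>a \<subseteq> interval b s. x a"
    and empty: "\<not> x {}" "\<not> rho {}"
    and star: "\<And>A R X c. \<lbrakk>finite A; finite R; finite X; A \<inter> R = {}; A \<inter> X = {}; R \<inter> X = {};
      x A = c; rho R = c; y (A \<union> X) = c\<rbrakk> \<Longrightarrow> y (R \<union> X) = c"
  shows False
proof -
  have ev: "\<exists>D. finite D \<and> (\<forall>F. finite F \<and> F \<inter> D = {} \<and> rho F \<longrightarrow> x F)"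
    by (rule eventual_implication[where x = x and y = y and rho = rho])
      (rule b free empty star; assumption)+
  obtain D1 where D1: "finite D1" "\<And>F. finite F \<Longrightarrow> F \<inter> D1 = {} \<Longrightarrow> rho F \<Longrightarrow> x F"
    using ev by blast
  \<comment> \<open>Contraposing the rule swaps \<open>x\<close> with \<open>rho\<close> and negates
    \<open>y\<close>, so the same lemma yields the converse implication.\<close>
  have "\<exists>D. finite D \<and> (\<forall>F. finite F \<and> F \<inter> D = {} \<and> x F \<longrightarrow> rho F)"
  proof (rule eventual_implication[where x = rho and y = "\<lambda>S. \<not> y S"])
    show "cube_free b (\<lambda>S. \<not> y S)"
      using free by (simp add: cube_free_complement)
    show "(\<not> y (R \<union> X)) = c"
      if "finite A" "finite R" "finite X" "A \<inter> R = {}" "A \<inter> X = {}" "R \<inter> X = {}"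
        "rho A = c" "x R = c" "(\<not> y (A \<union> X)) = c" for A R X c
      using star[of R A X c] that by (cases c) auto
  qed (use b empty in auto)
  then obtain D2 where D2: "finite D2" "\<And>F. finite F \<Longrightarrow> F \<inter> D2 = {} \<Longrightarrow> x F \<Longrightarrow> rho F"
    by blast
  define D where "D = D1 \<union> D2"
  have finD: "finite D" by (simp add: D_def D1 D2)
  have eq: "rho F = x F" if "finite F" "F \<inter> D = {}" for F
    using D1(2)[of F] D2(2)[of F] that by (auto simp: D_def)
  have swap: "y (A \<union> X) = y (R \<union> X)"
    if "finite A" "finite R" "finite X" "A \<inter> R = {}" "A \<inter> X = {}" "R \<inter> X = {}"
      "A \<inter> D = {}" "R \<inter> D = {}" "x A = x R" for A R X
  proof -
    have "rho R = x A" "rho A = x A" using eq that by simp_all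
    then have "y (A \<union> X) = x A \<Longrightarrow> y (R \<union> X) = x A" "y (R \<union> X) = x A \<Longrightarrow> y (A \<union> X) = x A"
      using star[of A R X "x A"] star[of R A X "x A"] that by (simp_all add: Int_commute)
    then show ?thesis by blast
  qed
  \<comment> \<open>Otherwise take a far block. Each subset \<open>a\<close> of it can be exchanged
    with \<open>G\<close> or with \<open>{}\<close>, according to \<open>x a\<close>, so
    \<open>y (X \<union> a)\<close> would always equal \<open>y X\<close>.\<close>
  have flip: "y (G \<union> X) \<noteq> y X"
    if G: "finite G" "finite X" "G \<inter> X = {}" "G \<inter> D = {}" "x G" for G X
  proof
    assume same: "y (G \<union> X) = y X"
    obtain s where s: "interval b s \<inter> (G \<union> X \<union> D) = {}"
      using eventually_interval_disjoint[OF b, of "G \<union> X \<union> D"] G finD by blast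
    obtain a where a: "a \<subseteq> interval b s" "y (X \<union> a) \<noteq> y X"
      using cube_free_interval[OF free, of X s "y X"] s G by blast
    have fina: "finite a" using a finite_subset by blast
    have disj: "a \<inter> G = {}" "a \<inter> X = {}" "a \<inter> D = {}" using a(1) s by blast+
    have "y (a \<union> X) = y X"
    proof (cases "x a")
      case True
      then show ?thesis using swap[of a G X] fina disj G same by simp
    next
      case False
      then show ?thesis using swap[of a "{}" X] fina disj G empty by simp
    qed
    then show False using a(2) by (simp add: Un_commute)
  qed
  have shift: "y (A \<union> X) = (y X \<noteq> x A)"
    if "finite A" "finite X" "A \<inter> X = {}" "A \<inter> D = {}" for A X
  proof (cases "x A")
    case True
    then show ?thesis using flip[of A X] that by simp
  next
    case False
    then show ?thesis using swap[of A "{}" X] that empty by simp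
  qed
  \<comment> \<open>\<open>A \<union> B\<close> is reached from \<open>{}\<close> in one step or by
    adding \<open>B\<close> first and then \<open>A\<close>; comparing the two values of
    \<open>y\<close> gives additivity modulo 2.\<close>
  have additive: "x (A \<union> B) = (x A \<noteq> x B)"
    if "finite A" "finite B" "A \<inter> B = {}" "A \<inter> D = {}" "B \<inter> D = {}" for A B
  proof -
    have "y (A \<union> B) = (y B \<noteq> x A)" "y B = (y {} \<noteq> x B)" "y (A \<union> B) = (y {} \<noteq> x (A \<union> B))"
      using shift[of A B] shift[of B "{}"] shift[of "A \<union> B" "{}"] that
      by (simp_all add: Int_Un_distrib2)
    then show ?thesis by blast
  qed
  obtain s0 where s0: "\<And>s. s \<ge> s0 \<Longrightarrow> interval b s \<inter> D = {}"
    using eventually_interval_disjoint[OF b finD] by blast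
  define N where "N = interval b s0"
  have ND: "N \<inter> D = {}" using s0[of s0] by (simp add: N_def)
  obtain P where P: "\<And>s. P s \<subseteq> interval b s" "\<And>s. x (P s)"
    using nonzero by metis
  have finP: "finite (P s)" for s
    using P(1) finite_subset by blast
  \<comment> \<open>Every direction is made even: if \<open>{i}\<close> is odd for \<open>x\<close>,
    an odd set is attached. Taking it from block \<open>Suc (s0 + i)\<close>, a different one for
    each \<open>i\<close>, puts it beyond \<open>N\<close> and keeps the directions
    disjoint.\<close>
  define Y where "Y i = (if x {i} then P (Suc (s0 + i)) else {})" for i
  have YD: "Y i \<inter> D = {}" for i
    using s0[of "Suc (s0 + i)"] P(1)[of "Suc (s0 + i)"] by (auto simp: Y_def)
  have finY: "finite (Y i)" for i
    by (simp add: Y_def finP)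
  have mono: "b s \<le> b t" if "s \<le> t" for s t
    using b that by (simp add: strict_mono_less_eq)
  have Ylow: "Y i \<subseteq> {b (Suc s0)..}" for i
    using P(1)[of "Suc (s0 + i)"] mono[of "Suc s0" "Suc (s0 + i)"] by (auto simp: Y_def)
  have interval_disj: "interval b s \<inter> interval b t = {}" if "s \<noteq> t" for s t
    using mono[of "Suc s" t] mono[of "Suc t" s] that by (cases "s < t") auto
  have Ydisj: "Y i \<inter> Y j = {}" if "i \<noteq> j" for i j
  proof -
    have "interval b (Suc (s0 + i)) \<inter> interval b (Suc (s0 + j)) = {}"
      using that by (intro interval_disj) simp
    then have "P (Suc (s0 + i)) \<inter> P (Suc (s0 + j)) = {}"
      using P(1)[of "Suc (s0 + i)"] P(1)[of "Suc (s0 + j)"] by blast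
    then show ?thesis by (simp add: Y_def)
  qed
  have "is_cube b s0 {} Y"
    using finY Ylow Ydisj by (auto simp: is_cube_def disjoint_family_on_def)
  from cube_freeD[OF free this, of "y {}"] obtain a
    where a: "a \<subseteq> N" "y (cube_point {} Y a) \<noteq> y {}" by (auto simp: N_def)
  have fina: "finite a" using a(1) finite_subset by (auto simp: N_def)
  have even: "\<not> x (cube_point {} Y a')" if "a' \<subseteq> N" for a'
  proof -
    have "finite a'" using that finite_subset by (auto simp: N_def)
    then show ?thesis using that
    proof (induction a')
      case empty
      then show ?case using assms(4) by (simp add: cube_point_def)
    next
      case (insert i a')
      have i: "i \<in> N" "a' \<subseteq> N" using insert.prems by auto
      have Nlow: "j < b (Suc s0)" if "j \<in> N" for j
        using that by (simp add: N_def)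
      have iY: "{i} \<inter> Y i = {}"
        using Nlow[OF i(1)] Ylow[of i] by auto
      have step: "\<not> x ({i} \<union> Y i)"
        using additive[of "{i}" "Y i"] iY i ND YD[of i] finY P(2) assms(4)
        by (auto simp: Y_def split: if_splits)
      have disj: "({i} \<union> Y i) \<inter> cube_point {} Y a' = {}"
        using insert.hyps Ydisj[of i] Ylow i Nlow
        by (fastforce simp: cube_point_def)
      have "cube_point {} Y (insert i a') = ({i} \<union> Y i) \<union> cube_point {} Y a'"
        by (auto simp: cube_point_def)
      moreover have "x (({i} \<union> Y i) \<union> cube_point {} Y a') =
          (x ({i} \<union> Y i) \<noteq> x (cube_point {} Y a'))"
        using disj finY insert.hyps YD i ND
        by (intro additive) (auto simp: cube_point_def)
      ultimately show ?case
        using step insert.IH i by simp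
    qed
  qed
  have "y (cube_point {} Y a \<union> {}) = (y {} \<noteq> x (cube_point {} Y a))"
    using fina finY YD a ND by (intro shift) (auto simp: cube_point_def)
  then show False
    using even[OF a(1)] a(2) by simp
qed

section \<open>Counting patterns on a finite window\<close>

text \<open>With \<open>x A = w (N \<union> A \<union> X0 \<union> X1) = c\<close>, the sets \<open>a \<union> X0\<close> and \<open>(N - a) \<union> X1\<close> show that \<open>z\<close> at \<open>a\<close> and
  \<open>y\<close> at \<open>N - a\<close> are not both \<open>c\<close>. For \<open>c = False\<close> this bounds the number of zeros of \<open>y\<close> by the
  number of ones of \<open>z\<close>, for \<open>c = True\<close> conversely; when both are maximal, the patterns are
  complementary.\<close>

lemma complementary_patterns:
  assumes b: "strict_mono b"
    and free: "cube_free b x" "cube_free b w"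
    and square: "\<And>A X0 X1 c. \<lbrakk>finite A; finite X0; finite X1; A \<inter> X0 = {}; A \<inter> X1 = {};
      X0 \<inter> X1 = {}; x A = c; y (A \<union> X1) = c; z (A \<union> X0) = c; w (A \<union> X0 \<union> X1) = c\<rbrakk> \<Longrightarrow> False"
    and N: "finite N"
  shows "\<exists>A X0 X1. finite A \<and> finite X0 \<and> finite X1 \<and> N \<inter> (A \<union> X0 \<union> X1) = {} \<and>
    A \<inter> X0 = {} \<and> A \<inter> X1 = {} \<and> X0 \<inter> X1 = {} \<and> \<not> x A \<and> \<not> w (N \<union> A \<union> X0 \<union> X1) \<and>
    (\<forall>a \<subseteq> N. z (a \<union> A \<union> X0) = (\<not> y ((N - a) \<union> A \<union> X1)))"
proof -
  define ok where "ok P \<longleftrightarrow> finite P \<and> P \<inter> N = {}" for P :: "nat set"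
  define ones where "ones P = {a \<in> Pow N. z (a \<union> P)}" for P
  define zeros where "zeros P = {a \<in> Pow N. \<not> y (a \<union> P)}" for P
  have finones: "finite (ones P)" "finite (zeros P)" for P
    using N by (simp_all add: ones_def zeros_def)
  \<comment> \<open>The least such \<open>k\<close> is the limit superior of
    \<open>card (ones P)\<close> along growing \<open>P\<close>. A plain maximum could be lost when
    \<open>P\<close> is enlarged to steer \<open>x\<close> and \<open>w\<close>.\<close>
  define Q where "Q k \<longleftrightarrow> (\<exists>P0. ok P0 \<and> (\<forall>P. ok P \<and> P0 \<subseteq> P \<longrightarrow> card (ones P) \<le> k))" for k
  have "Q (card (Pow N))"
    using N unfolding Q_def
    by (intro exI[of _ "{}"]) (auto simp: ok_def ones_def intro!: card_mono)
  define k where "k = (LEAST k. Q k)"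
  have "Q k" unfolding k_def by (rule LeastI) fact
  then obtain P0 where P0: "ok P0" and upper: "\<And>P. ok P \<Longrightarrow> P0 \<subseteq> P \<Longrightarrow> card (ones P) \<le> k"
    unfolding Q_def by blast
  have attained: "\<exists>P'. ok P' \<and> P \<subseteq> P' \<and> card (ones P') = k" if P: "ok P" "P0 \<subseteq> P" for P
  proof (rule ccontr)
    assume "\<not> ?thesis"
    then have less: "card (ones P') < k" if "ok P'" "P \<subseteq> P'" for P'
      using upper[of P'] that P by (metis order_le_imp_less_or_eq order_trans)
    then have "card (ones P') \<le> k - 1" if "ok P'" "P \<subseteq> P'" for P'
      using that by fastforce
    then have "Q (k - 1)"
      unfolding Q_def using P by blast
    \<comment> \<open>The subtraction does not truncate: a cardinality lies below \<open>k\<close>,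
      so \<open>k\<close> is positive.\<close>
    moreover have "k - 1 < k"
      using less[OF P(1)] by simp
    ultimately show False
      unfolding k_def using not_less_Least by blast
  qed
  have exclusive: "z (a \<union> A \<union> X0) \<noteq> c"
    if "ok A" "ok X0" "ok X1" "A \<inter> X0 = {}" "A \<inter> X1 = {}" "X0 \<inter> X1 = {}" "a \<subseteq> N"
      "x A = c" "w (N \<union> A \<union> X0 \<union> X1) = c" "y ((N - a) \<union> A \<union> X1) = c" for A X0 X1 a c
  proof
    assume z: "z (a \<union> A \<union> X0) = c"
    have e: "A \<union> ((N - a) \<union> X1) = (N - a) \<union> A \<union> X1" "A \<union> (a \<union> X0) = a \<union> A \<union> X0"
      "A \<union> (a \<union> X0) \<union> ((N - a) \<union> X1) = N \<union> A \<union> X0 \<union> X1"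
      using that(7) by blast+
    have fina: "finite a" using that(7) N by (rule finite_subset)
    show False
    proof (rule square[of A "a \<union> X0" "(N - a) \<union> X1" c])
      show "A \<inter> (a \<union> X0) = {}" "A \<inter> ((N - a) \<union> X1) = {}" "(a \<union> X0) \<inter> ((N - a) \<union> X1) = {}"
        using that(1-7) unfolding ok_def by blast+
      show "y (A \<union> ((N - a) \<union> X1)) = c" unfolding e(1) by (rule that)
      show "z (A \<union> (a \<union> X0)) = c" unfolding e(2) by (rule z)
      show "w (A \<union> (a \<union> X0) \<union> ((N - a) \<union> X1)) = c" unfolding e(3) by (rule that)
      show "x A = c" by (rule that)
    qed (use that(1-3) fina N in \<open>simp_all add: ok_def\<close>)
  qed
  \<comment> \<open>Colour \<open>True\<close>: \<open>V\<close> makes \<open>x A\<close> true,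
    \<open>P'\<close> enlarges \<open>A\<close> to a set with \<open>k\<close> ones, and
    \<open>X1\<close> comes last because \<open>w\<close> sees all the other sets. Complements of
    ones are then zeros.\<close>
  have many_zeros: "\<exists>T. ok T \<and> P \<subseteq> T \<and> k \<le> card (zeros T)" if P: "ok P" "P0 \<subseteq> P" for P
  proof -
    obtain V where V: "finite V" "V \<inter> (N \<union> P) = {}" "x (P \<union> V) = True"
      using cube_free_dense[OF b free(1), of P "N \<union> P" True] P N by (auto simp: ok_def)
    define A where "A = P \<union> V"
    have A: "ok A" "P0 \<subseteq> A" using P V by (auto simp: A_def ok_def)
    obtain P' where P': "ok P'" "A \<subseteq> P'" "card (ones P') = k"
      using attained[OF A] by blast
    define X0 where "X0 = P' - A"
    have X0: "ok X0" "A \<inter> X0 = {}" "P' = A \<union> X0" using P' by (auto simp: X0_def ok_def)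
    obtain X1 where X1: "finite X1" "X1 \<inter> (N \<union> A \<union> X0) = {}" "w (N \<union> A \<union> X0 \<union> X1) = True"
      using cube_free_dense[OF b free(2), of "N \<union> A \<union> X0" "N \<union> A \<union> X0" True] N A X0
      by (auto simp: ok_def)
    have "(\<lambda>a. N - a) ` ones P' \<subseteq> zeros (A \<union> X1)"
    proof (intro image_subsetI)
      fix a assume "a \<in> ones P'"
      then show "N - a \<in> zeros (A \<union> X1)"
        using exclusive[of A X0 X1 a True] A X0 X1 V
        by (auto simp: ones_def zeros_def ok_def A_def[symmetric] ac_simps)
    qed
    then have "card ((\<lambda>a. N - a) ` ones P') \<le> card (zeros (A \<union> X1))"
      using finones by (intro card_mono) auto
    moreover have "inj_on (\<lambda>a. N - a) (ones P')"
      by (rule inj_onI) (auto simp: ones_def)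
    ultimately have "k \<le> card (zeros (A \<union> X1))"
      using P'(3) by (simp add: card_image)
    then show ?thesis
      using A X1 by (intro exI[of _ "A \<union> X1"]) (auto simp: ok_def A_def)
  qed
  \<comment> \<open>Colour \<open>False\<close>: the complements of the zeros of \<open>T\<close>,
    at least \<open>k\<close> in number, are ones of \<open>A \<union> X0\<close>, of which there
    are at most \<open>k\<close>. So the two families match exactly.\<close>
  obtain V where V: "finite V" "V \<inter> (N \<union> P0) = {}" "x (P0 \<union> V) = False"
    using cube_free_dense[OF b free(1), of P0 "N \<union> P0" False] P0 N by (auto simp: ok_def)
  define A where "A = P0 \<union> V"
  have A: "ok A" "P0 \<subseteq> A" "\<not> x A" using P0 V by (auto simp: A_def ok_def)
  obtain T where T: "ok T" "A \<subseteq> T" "k \<le> card (zeros T)"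
    using many_zeros[OF A(1,2)] by blast
  define X1 where "X1 = T - A"
  have X1: "ok X1" "A \<inter> X1 = {}" "T = A \<union> X1" using T by (auto simp: X1_def ok_def)
  obtain X0 where X0: "finite X0" "X0 \<inter> (N \<union> A \<union> X1) = {}" "w (N \<union> A \<union> X1 \<union> X0) = False"
    using cube_free_dense[OF b free(2), of "N \<union> A \<union> X1" "N \<union> A \<union> X1" False] N A X1
    by (auto simp: ok_def)
  have okX0: "ok X0" using X0 by (auto simp: ok_def)
  have w: "\<not> w (N \<union> A \<union> X0 \<union> X1)" using X0(3) by (simp add: ac_simps)
  have sub: "(\<lambda>a. N - a) ` zeros T \<subseteq> ones (A \<union> X0)"
  proof (intro image_subsetI)
    fix a assume "a \<in> zeros T"
    then have "a \<subseteq> N" "\<not> y ((N - (N - a)) \<union> A \<union> X1)"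
      using X1(3) by (auto simp: zeros_def double_diff ac_simps)
    then show "N - a \<in> ones (A \<union> X0)"
      using exclusive[of A X0 X1 "N - a" False] A X1 X0 okX0 w
      by (auto simp: ones_def ac_simps)
  qed
  have inj: "inj_on (\<lambda>a. N - a) (zeros T)"
    by (rule inj_onI) (auto simp: zeros_def)
  have "card (ones (A \<union> X0)) \<le> k"
    using A okX0 by (intro upper) (auto simp: ok_def)
  then have eq: "(\<lambda>a. N - a) ` zeros T = ones (A \<union> X0)"
    using sub T(3) finones inj by (intro card_seteq) (auto simp: card_image)
  have "z (a \<union> A \<union> X0) = (\<not> y ((N - a) \<union> A \<union> X1))" if a: "a \<subseteq> N" for a
  proof -
    have "z (a \<union> A \<union> X0) \<longleftrightarrow> a \<in> (\<lambda>a. N - a) ` zeros T"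
      using a unfolding eq by (simp add: ones_def Un_assoc)
    also have "\<dots> \<longleftrightarrow> N - a \<in> zeros T"
    proof
      assume "a \<in> (\<lambda>a. N - a) ` zeros T"
      then obtain a' where a': "a' \<in> zeros T" "a = N - a'" by blast
      then have "N - a = a'" by (auto simp: zeros_def)
      then show "N - a \<in> zeros T" using a'(1) by simp
    next
      assume "N - a \<in> zeros T"
      then have "N - (N - a) \<in> (\<lambda>a. N - a) ` zeros T" by (rule imageI)
      then show "a \<in> (\<lambda>a. N - a) ` zeros T" using a by (simp add: double_diff)
    qed
    also have "\<dots> \<longleftrightarrow> \<not> y ((N - a) \<union> A \<union> X1)"
      using X1(3) by (auto simp: zeros_def Un_assoc)
    finally show ?thesis .
  qed
  then show ?thesis
    using A X1 X0 okX0 w by (intro exI[of _ A] exI[of _ X0] exI[of _ X1]) (auto simp: ok_def)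
qed

section \<open>The limit over growing windows\<close>

lemma no_square_free_structure:
  assumes b: "strict_mono b"
    and free: "cube_free b x" "cube_free b y" "cube_free b w"
    and square: "\<And>A X0 X1 c. \<lbrakk>finite A; finite X0; finite X1; A \<inter> X0 = {}; A \<inter> X1 = {};
      X0 \<inter> X1 = {}; x A = c; y (A \<union> X1) = c; z (A \<union> X0) = c; w (A \<union> X0 \<union> X1) = c\<rbrakk> \<Longrightarrow> False"
  shows False
proof -
  have "\<forall>M. \<exists>A X0 X1. finite A \<and> finite X0 \<and> finite X1 \<and> {..<M} \<inter> (A \<union> X0 \<union> X1) = {} \<and>
    A \<inter> X0 = {} \<and> A \<inter> X1 = {} \<and> X0 \<inter> X1 = {} \<and> \<not> x A \<and> \<not> w ({..<M} \<union> A \<union> X0 \<union> X1) \<and>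
    (\<forall>a \<subseteq> {..<M}. z (a \<union> A \<union> X0) = (\<not> y (({..<M} - a) \<union> A \<union> X1)))"
    by (rule allI, rule complementary_patterns[OF b free(1,3)]) (rule square; assumption | simp)+
  then obtain A X0 X1 where fin: "\<And>M. finite (A M)" "\<And>M. finite (X0 M)" "\<And>M. finite (X1 M)"
    and out: "\<And>M. {..<M} \<inter> (A M \<union> X0 M \<union> X1 M) = {}"
    and disj: "\<And>M. A M \<inter> X0 M = {}" "\<And>M. A M \<inter> X1 M = {}" "\<And>M. X0 M \<inter> X1 M = {}"
    and base: "\<And>M. \<not> x (A M)" "\<And>M. \<not> w ({..<M} \<union> A M \<union> X0 M \<union> X1 M)"
    and compl: "\<And>M a. a \<subseteq> {..<M} \<Longrightarrow>
      z (a \<union> A M \<union> X0 M) = (\<not> y (({..<M} - a) \<union> A M \<union> X1 M))"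
    by metis
  \<comment> \<open>The third component reads \<open>w\<close> at the complement within the window,
    which becomes \<open>rho\<close> in the limit; \<open>z\<close> is omitted since
    \<open>compl\<close> expresses it by \<open>y\<close>.\<close>
  define F where "F M S = (x (S \<union> A M), y (S \<union> A M \<union> X1 M),
    w (({..<M} - S) \<union> A M \<union> X0 M \<union> X1 M))" for M S
  obtain G where G: "\<And>K L. finite K \<Longrightarrow> \<forall>S \<in> K. finite S \<Longrightarrow> \<exists>M \<ge> L. \<forall>S \<in> K. F M S = G S"
    using infinite_cluster_finite_sets[of F] by blast
  define x' where "x' S = fst (G S)" for S
  define y' where "y' S = fst (snd (G S))" for S
  define rho where "rho S = snd (snd (G S))" for S
  have agree: "\<exists>M \<ge> L. \<forall>S \<in> K. x (S \<union> A M) = x' S \<and> y (S \<union> A M \<union> X1 M) = y' S \<and>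
      w (({..<M} - S) \<union> A M \<union> X0 M \<union> X1 M) = rho S"
    if K: "finite K" "\<forall>S \<in> K. finite S" for K L
  proof -
    obtain M where "M \<ge> L" "\<And>S. S \<in> K \<Longrightarrow> G S = F M S"
      using G[OF K, of L] by metis
    then show ?thesis
      by (intro exI[of _ M]) (auto simp: x'_def y'_def rho_def F_def)
  qed
  show False
  proof (rule no_exchange_structure[where x = x' and y = y' and rho = rho, OF b])
    show "cube_free b y'"
      unfolding cube_free_def
    proof (intro allI impI)
      fix s U Y c assume cube: "is_cube b s U Y"
      let ?I = "interval b s"
      let ?K = "cube_point U Y ` Pow ?I"
      have finU: "finite U" and finY: "\<And>i. i \<in> ?I \<Longrightarrow> finite (Y i)"
        using cube by (auto simp: is_cube_def)
      then have finp: "finite (cube_point U Y a)" if "a \<subseteq> ?I" for a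
        using that finite_subset[OF that] by (auto simp: cube_point_def)
      obtain L where L: "cube_point U Y ?I \<subseteq> {..<L}"
        using finp[of ?I] finite_nat_iff_bounded by blast
      obtain M where M: "M \<ge> L" "\<And>a. a \<subseteq> ?I \<Longrightarrow>
          y (cube_point U Y a \<union> A M \<union> X1 M) = y' (cube_point U Y a)"
        using agree[of ?K L] finp by auto
      have low: "U \<union> ?I \<union> (\<Union>i\<in>?I. Y i) \<subseteq> {..<M}"
        using L M(1) by (auto simp: cube_point_def)
      \<comment> \<open>The added sets lie beyond the window \<open>{..<M}\<close>, which contains
        the whole cube, so the translate is again a cube.\<close>
      have "is_cube b s (U \<union> A M \<union> X1 M) Y"
        unfolding Un_assoc
      proof (rule is_cube_extend[OF cube])
        show "(A M \<union> X1 M) \<inter> (?I \<union> (\<Union>i\<in>?I. Y i)) = {}"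
          using low out[of M] by blast
      qed (use fin in simp)
      from cube_freeD[OF free(2) this, of c] obtain a where a: "a \<subseteq> ?I"
        "y (cube_point (U \<union> A M \<union> X1 M) Y a) \<noteq> c" by blast
      moreover have "cube_point (U \<union> A M \<union> X1 M) Y a = cube_point U Y a \<union> A M \<union> X1 M"
        by (auto simp: cube_point_def)
      ultimately show "\<exists>a \<subseteq> ?I. y' (cube_point U Y a) \<noteq> c"
        using M(2)[OF a(1)] by auto
    qed
    show "\<exists>a \<subseteq> interval b s. x' a" for s
    proof -
      have finI: "finite a" if "a \<subseteq> interval b s" for a
        using that finite_subset by blast
      obtain M where M: "M \<ge> b (Suc s)" "\<And>a. a \<subseteq> interval b s \<Longrightarrow> x (a \<union> A M) = x' a"
        using agree[of "Pow (interval b s)" "b (Suc s)"] finI by auto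
      have "A M \<inter> interval b s = {}"
        using out[of M] M(1) by (auto simp: disjoint_iff)
      from cube_free_interval[OF free(1) fin(1) this, of False] obtain a
        where "a \<subseteq> interval b s" "x (a \<union> A M)" by (auto simp: Un_commute)
      then show ?thesis using M(2) by blast
    qed
    show "\<not> x' {}" "\<not> rho {}"
      using agree[of "{{}}"] base by auto
    show "y' (R \<union> X) = c"
      if S: "finite S" "finite R" "finite X" "S \<inter> R = {}" "S \<inter> X = {}" "R \<inter> X = {}"
        and c: "x' S = c" "rho R = c" "y' (S \<union> X) = c" for S R X c
    proof (rule ccontr)
      assume neg: "y' (R \<union> X) \<noteq> c"
      obtain L where L: "S \<union> R \<union> X \<subseteq> {..<L}"
        using S finite_nat_iff_bounded[of "S \<union> R \<union> X"] by auto
      let ?K = "{S, R, S \<union> X, R \<union> X}"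
      have "finite ?K" "\<forall>T \<in> ?K. finite T" using S(1-3) by simp_all
      from agree[OF this, of L] obtain M where "M \<ge> L"
        and M: "x (S \<union> A M) = x' S" "y (S \<union> X \<union> A M \<union> X1 M) = y' (S \<union> X)"
          "y (R \<union> X \<union> A M \<union> X1 M) = y' (R \<union> X)"
          "w (({..<M} - R) \<union> A M \<union> X0 M \<union> X1 M) = rho R"
        by blast
      have low: "S \<union> R \<union> X \<subseteq> {..<M}"
        using L \<open>M \<ge> L\<close> by (meson lessThan_subset_iff order_trans)
      \<comment> \<open>\<open>?X0\<close> fills up the window. From \<open>S \<union> A M\<close>,
        adding \<open>X \<union> X1 M\<close> leads to \<open>y'\<close> at
        \<open>S \<union> X\<close>; adding \<open>?X0\<close> leads to the complement of
        \<open>R \<union> X\<close>, where \<open>z\<close> negates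
        \<open>y' (R \<union> X)\<close>; adding both leads to the complement of \<open>R\<close>,
        where \<open>w\<close> is \<open>rho R\<close>.\<close>
      let ?X0 = "({..<M} - (S \<union> R \<union> X)) \<union> X0 M"
      have "{..<M} - ({..<M} - (R \<union> X)) = R \<union> X" using low by auto
      then have z: "z (({..<M} - (R \<union> X)) \<union> A M \<union> X0 M) = c"
        using compl[of "{..<M} - (R \<union> X)" M] neg M(3) by auto
      have e1: "(S \<union> A M) \<union> (X \<union> X1 M) = S \<union> X \<union> A M \<union> X1 M"
        by blast
      have e2: "(S \<union> A M) \<union> ?X0 = ({..<M} - (R \<union> X)) \<union> A M \<union> X0 M"
        using low S(4-6) by blast
      have e3: "(S \<union> A M) \<union> ?X0 \<union> (X \<union> X1 M) = ({..<M} - R) \<union> A M \<union> X0 M \<union> X1 M"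
        using low S(4-6) by blast
      show False
      proof (rule square[of "S \<union> A M" ?X0 "X \<union> X1 M" c])
        show "(S \<union> A M) \<inter> ?X0 = {}" "(S \<union> A M) \<inter> (X \<union> X1 M) = {}" "?X0 \<inter> (X \<union> X1 M) = {}"
          using low out[of M] disj[of M] S(5) by blast+
        show "y ((S \<union> A M) \<union> (X \<union> X1 M)) = c" unfolding e1 M(2) by (rule c)
        show "z ((S \<union> A M) \<union> ?X0) = c" unfolding e2 by (rule z)
        show "w ((S \<union> A M) \<union> ?X0 \<union> (X \<union> X1 M)) = c" unfolding e3 M(4) by (rule c)
        show "x (S \<union> A M) = c" unfolding M(1) by (rule c)
      qed (use S(1,3) fin in simp_all)
    qed
  qed
qed

section \<open>Splitting off the first block\<close>

text \<open>Positions are not renumbered: the remaining blocks start at \<open>b 1\<close>, and the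
  intersection with \<open>{b 1..}\<close> replaces whatever a set contains below \<open>b 1\<close>
  by the fixed pattern \<open>P\<close>.\<close>

lemma cube_free_trace:
  assumes "cube_free b g" "strict_mono b" "finite P" "P \<subseteq> {..<b 1}"
  shows "cube_free (\<lambda>s. b (Suc s)) (\<lambda>S. g (P \<union> (S \<inter> {b 1..})))"
  unfolding cube_free_def
proof (intro allI impI)
  fix s U Y c assume cube: "is_cube (\<lambda>s. b (Suc s)) s U Y"
  have le: "b 1 \<le> b (Suc s)" "b (Suc s) \<le> b (Suc (Suc s))"
    using assms(2) by (simp_all add: strict_mono_less_eq)
  have "is_cube b (Suc s) (P \<union> (U \<inter> {b 1..})) Y"
    unfolding is_cube_def
  proof (intro conjI ballI)
    fix i assume i: "i \<in> interval b (Suc s)"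
    then have Y: "finite (Y i)" "Y i \<subseteq> {b (Suc (Suc s))..}" "Y i \<inter> U = {}"
      using cube by (auto simp: is_cube_def)
    then show "finite (Y i)" "Y i \<subseteq> {b (Suc (Suc s))..}" by auto
    show "Y i \<inter> (P \<union> (U \<inter> {b 1..})) = {}"
      using Y le assms(4) by fastforce
  next
    show "(P \<union> (U \<inter> {b 1..})) \<inter> interval b (Suc s) = {}"
      using cube le assms(4) by (fastforce simp: is_cube_def)
  qed (use cube assms(3) in \<open>auto simp: is_cube_def\<close>)
  from cube_freeD[OF assms(1) this, of c] obtain a where a: "a \<subseteq> interval b (Suc s)"
    "g (cube_point (P \<union> (U \<inter> {b 1..})) Y a) \<noteq> c" by blast
  have "a \<subseteq> {b 1..}" "(\<Union>i\<in>a. Y i) \<subseteq> {b 1..}"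
    using a(1) le cube by (fastforce simp: is_cube_def)+
  then have "cube_point (P \<union> (U \<inter> {b 1..})) Y a = P \<union> (cube_point U Y a \<inter> {b 1..})"
    by (auto simp: cube_point_def)
  then show "\<exists>a \<subseteq> interval (\<lambda>s. b (Suc s)) s. g (P \<union> (cube_point U Y a \<inter> {b 1..})) \<noteq> c"
    using a by auto
qed

text \<open>A cube over the first block \<open>{0, 1}\<close> has four points. With base
  \<open>A\<close>, \<open>Y 0 = X0\<close> and \<open>Y 1 = X1\<close>, all cut down to
  \<open>{2..}\<close>, a constant cube is exactly the forbidden square.\<close>

lemma no_cube_free_from_two:
  assumes b: "strict_mono b" "b 0 = 0" "b 1 = 2" and free: "cube_free b g"
  shows False
proof -
  let ?h = "\<lambda>P S. g (P \<union> (S \<inter> {2..}))"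
  have trace: "cube_free (\<lambda>s. b (Suc s)) (?h P)" if "P \<subseteq> {..<2}" for P
    using cube_free_trace[OF free b(1), of P] that b(3) finite_subset[OF that] by simp
  show False
  proof (rule no_square_free_structure[where x = "?h {}" and y = "?h {1}" and z = "?h {0}"
        and w = "?h {0, 1}"])
    show "strict_mono (\<lambda>s. b (Suc s))"
      using b(1) by (simp add: strict_mono_def)
    fix A X0 X1 :: "nat set" and c
    assume fin: "finite A" "finite X0" "finite X1"
      and disj: "A \<inter> X0 = {}" "A \<inter> X1 = {}" "X0 \<inter> X1 = {}"
      and c: "?h {} A = c" "?h {1} (A \<union> X1) = c" "?h {0} (A \<union> X0) = c"
        "?h {0, 1} (A \<union> X0 \<union> X1) = c"
    define U where "U = A \<inter> {2..}"
    define Y where "Y i = (if i = 0 then X0 else X1) \<inter> {2..}" for i :: nat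
    have I: "interval b 0 = {0, 1}" using b by auto
    have "is_cube b 0 U Y"
      using fin disj b(3) unfolding is_cube_def I
      by (auto simp: U_def Y_def disjoint_family_on_def)
    from cube_freeD[OF free this, of c] obtain a
      where a: "a \<subseteq> {0, 1}" "g (cube_point U Y a) \<noteq> c" unfolding I by blast
    have "a = {} \<or> a = {0} \<or> a = {1} \<or> a = {0, 1}"
      using a(1) by blast
    moreover have "cube_point U Y {} = {} \<union> (A \<inter> {2..})"
      "cube_point U Y {1} = {1} \<union> ((A \<union> X1) \<inter> {2..})"
      "cube_point U Y {0} = {0} \<union> ((A \<union> X0) \<inter> {2..})"
      "cube_point U Y {0, 1} = {0, 1} \<union> ((A \<union> X0 \<union> X1) \<inter> {2..})"
      by (auto simp: cube_point_def U_def Y_def)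
    ultimately show False using a(2) c by metis
  qed (use trace[of "{}"] trace[of "{1}"] trace[of "{0, 1}"] in simp_all)
qed

section \<open>From variable words to cubes\<close>

text \<open>The cube, cut off at \<open>b r\<close>, comes from a variable word with
  \<open>Var i\<close> at the positions of \<open>insert i (Y i)\<close>. As \<open>Y i\<close> lies
  beyond the block, the first occurrence of \<open>Var i\<close> is \<open>i\<close>, so first
  occurrences increase with the index.\<close>

lemma cube_not_monochromatic:
  fixes n :: "nat \<Rightarrow> nat"
  defines "b \<equiv> \<lambda>s. \<Sum>i<s. n i"
  assumes f: "\<not> sectionally_homogeneous f (map n [0..<r])" and s: "s < r"
    and cube: "is_cube b s U Y" and Ylow: "\<And>i. i \<in> interval b s \<Longrightarrow> Y i \<subseteq> {..<b r}"
  shows "\<exists>a \<subseteq> interval b s. f (map (\<lambda>t. t \<in> cube_point U Y a) [0..<b r]) \<noteq> c"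
proof (rule ccontr)
  assume "\<not> ?thesis"
  then have mono: "f (map (\<lambda>t. t \<in> cube_point U Y a) [0..<b r]) = c" if "a \<subseteq> interval b s" for a
    using that by blast
  let ?I = "interval b s"
  define Z where "Z i = insert i (Y i)" for i
  have Yfar: "Y i \<subseteq> {b (Suc s)..}" "Y i \<inter> U = {}" if "i \<in> ?I" for i
    using cube that by (auto simp: is_cube_def)
  have ble: "b s \<le> b t" if "s \<le> t" for s t
    unfolding b_def using that by (intro sum_mono2) auto
  have uniq: "i = j" if "i \<in> ?I" "j \<in> ?I" "t \<in> Z i" "t \<in> Z j" for i j t
  proof (rule ccontr)
    assume "i \<noteq> j"
    then have "Y i \<inter> Y j = {}"
      using cube that by (auto simp: is_cube_def disjoint_family_on_def)
    then show False
      using that Yfar[of i] Yfar[of j] \<open>i \<noteq> j\<close> by (fastforce simp: Z_def)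
  qed
  \<comment> \<open>By \<open>uniq\<close> at most one direction contains \<open>t\<close>, so the
    description is proper wherever \<open>letter\<close> uses it.\<close>
  define owner where "owner t = (THE i. i \<in> ?I \<and> t \<in> Z i)" for t
  have owner: "owner t = i" if "i \<in> ?I" "t \<in> Z i" for i t
    unfolding owner_def using that uniq by blast
  define letter where
    "letter t = (if \<exists>i \<in> ?I. t \<in> Z i then Var (owner t) else Const (t \<in> U))" for t
  define v where "v = map letter [0..<b r]"
  have letter_Var: "letter t = Var i \<longleftrightarrow> i \<in> ?I \<and> t \<in> Z i" for t i
    using owner by (auto simp: letter_def)
  have Ir: "i < b r" if "i \<in> ?I" for i
    using that ble[of "Suc s" r] s by auto
  have len: "length v = b r" by (simp add: v_def)
  have vnth: "v ! t = letter t" if "t < b r" for t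
    using that by (simp add: v_def)
  have vars: "vars v = ?I"
    using Ir by (auto simp: vars_def v_def image_iff letter_Var[symmetric] eq_commute[of "Var _"])
       (auto simp: letter_Var Z_def)
  have first: "first_occurrence v i = i" if i: "i \<in> ?I" for i
    unfolding first_occurrence_def
  proof (rule Least_equality)
    show "i < length v \<and> v ! i = Var i"
      using i Ir[OF i] by (simp add: len vnth letter_Var Z_def)
  next
    fix t assume "t < length v \<and> v ! t = Var i"
    then have "t \<in> Z i" using vnth[of t] letter_Var[of t i] by (simp add: len)
    then show "i \<le> t"
      using i Yfar[OF i] by (fastforce simp: Z_def)
  qed
  have sums: "sum_list (take t (map n [0..<r])) = b t" if "t \<le> r" for t
    using that by (simp add: take_map b_def sum_list_sum_nth atLeast0LessThan)
  have sum_all: "sum_list (map n [0..<r]) = b r"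
    using sums[of r] by simp
  have block: "block (map n [0..<r]) s = ?I"
    using s sums[of s] sums[of "Suc s"] by (simp add: block_def)
  have nth: "map n [0..<r] ! s = n s" using s by simp
  have bSuc: "b (Suc s) = b s + n s" by (simp add: b_def)
  have "is_variable_word (n s) v"
    using first by (auto simp: is_variable_word_def vars bSuc strict_mono_on_def)
  moreover have "first_occurrence v ` vars v = ?I"
    using first by (force simp: vars)
  moreover have "f (substitute v \<alpha>) = c" for \<alpha>
  proof -
    define a where "a = {i \<in> ?I. \<alpha> ! var_rank v i}"
    have "(case letter t of Const d \<Rightarrow> d | Var m \<Rightarrow> \<alpha> ! var_rank v m) \<longleftrightarrow> t \<in> cube_point U Y a" for t
    proof (cases "\<exists>i \<in> ?I. t \<in> Z i")
      case True
      then obtain i where i: "i \<in> ?I" "t \<in> Z i" by blast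
      have "U \<inter> ?I = {}"
        using cube by (simp add: is_cube_def)
      then have "t \<notin> U"
        using i Yfar(2)[OF i(1)] by (auto simp: Z_def)
      moreover have "j = i" if "j \<in> a" "t \<in> Z j" for j
        using uniq[of j i t] that i by (simp add: a_def)
      moreover have "cube_point U Y a = U \<union> (\<Union>j\<in>a. Z j)"
        by (auto simp: cube_point_def Z_def)
      ultimately have "t \<in> cube_point U Y a \<longleftrightarrow> i \<in> a"
        using i(2) by blast
      then show ?thesis
        using i letter_Var[of t i] by (simp add: a_def)
    next
      case False
      then show ?thesis
        by (auto simp: letter_def cube_point_def a_def Z_def)
    qed
    moreover have "map h v = map (\<lambda>t. h (letter t)) [0..<b r]" for h :: "letter \<Rightarrow> bool"
      by (simp add: v_def)
    ultimately have "substitute v \<alpha> = map (\<lambda>t. t \<in> cube_point U Y a) [0..<b r]"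
      by (simp add: substitute_def)
    moreover have "a \<subseteq> ?I" by (auto simp: a_def)
    ultimately show ?thesis
      using mono[of a] by simp
  qed
  ultimately have "sectionally_homogeneous f (map n [0..<r])"
    unfolding sectionally_homogeneous_def
    using s len by (intro exI[of _ s]) (auto simp: nth sum_all block intro!: exI[of _ v])
  then show False using f by blast
qed

text \<open>The colouring \<open>f r\<close> is read on finite sets through indicator words of
  length \<open>b r\<close>, and \<open>g\<close> is a cluster point. A cube has finitely many
  points, so for some large \<open>r\<close> it agrees with \<open>g\<close> on all of them.\<close>

lemma ENSH_imp_cube_free:
  fixes n :: "nat \<Rightarrow> nat"
  defines "b \<equiv> \<lambda>s. \<Sum>i<s. n i"
  assumes pos: "\<And>i. n i > 0" and ENSH: "\<And>r. r > 0 \<Longrightarrow> ENSH (map n [0..<r])"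
  shows "\<exists>g. cube_free b g"
proof -
  have mono: "strict_mono b"
    unfolding b_def by (simp add: strict_mono_Suc_iff pos)
  obtain f where f: "\<And>r. r > 0 \<Longrightarrow> \<not> sectionally_homogeneous (f r) (map n [0..<r])"
    using ENSH unfolding ENSH_def by metis
  define F where "F r S = f r (map (\<lambda>t. t \<in> S) [0..<b r])" for r and S :: "nat set"
  obtain g where g: "\<And>K L. finite K \<Longrightarrow> \<forall>S \<in> K. finite S \<Longrightarrow> \<exists>r \<ge> L. \<forall>S \<in> K. F r S = g S"
    using infinite_cluster_finite_sets[of F] by blast
  have "cube_free b g"
    unfolding cube_free_def
  proof (intro allI impI)
    fix s U Y c assume cube: "is_cube b s U Y"
    let ?I = "interval b s"
    have finp: "finite (cube_point U Y a)" if "a \<subseteq> ?I" for a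
      using that finite_subset[OF that] cube by (auto simp: cube_point_def is_cube_def)
    obtain L where L: "cube_point U Y ?I \<subseteq> {..<L}"
      using finp[of ?I] finite_nat_iff_bounded by blast
    \<comment> \<open>\<open>Suc s\<close> puts block \<open>s\<close> among the first
      \<open>r\<close> blocks; \<open>L\<close> makes the cube fit into length \<open>b r\<close>,
      since \<open>r \<le> b r\<close>.\<close>
    have "\<exists>r \<ge> max L (Suc s). \<forall>S \<in> cube_point U Y ` Pow ?I. F r S = g S"
      by (rule g) (use finp in auto)
    then obtain r where r: "r \<ge> L" "s < r"
      "\<And>a. a \<subseteq> ?I \<Longrightarrow> F r (cube_point U Y a) = g (cube_point U Y a)"
      by auto
    have "L \<le> b r"
      using r(1) strict_mono_imp_increasing[OF mono, of r] by simp
    then have "Y i \<subseteq> {..<b r}" if "i \<in> ?I" for i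
      using that L by (fastforce simp: cube_point_def)
    then obtain a where "a \<subseteq> ?I" "F r (cube_point U Y a) \<noteq> c"
      using cube_not_monochromatic[OF f r(2), of U Y c] r(2) cube
      unfolding F_def b_def by auto
    then show "\<exists>a \<subseteq> ?I. g (cube_point U Y a) \<noteq> c"
      using r(3) by auto
  qed
  then show ?thesis by blast
qed

theorem theorem4p6:
  fixes n :: "nat \<Rightarrow> nat"
  assumes "\<forall>i. n i > 0" and "n 0 = 2"
  shows "n \<notin> ENSH_seqs \<and> (\<exists>r > 0. \<not> ENSH (map n [0..<r]))"
proof -
  have "\<exists>r > 0. \<not> ENSH (map n [0..<r])"
  proof (rule ccontr)
    assume "\<not> ?thesis"
    then obtain g where "cube_free (\<lambda>s. \<Sum>i<s. n i) g"
      using ENSH_imp_cube_free[of n] assms(1) by blast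
    moreover have "strict_mono (\<lambda>s. \<Sum>i<s. n i)"
      by (simp add: strict_mono_Suc_iff assms(1))
    ultimately show False
      using no_cube_free_from_two assms(2) by fastforce
  qed
  then show ?thesis by (auto simp: ENSH_seqs_def)
qed

end
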